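(* Let $i \ge 0$ be an integer and let $G=(V,E)$ be an $\alpha_i$-metric graph. Then $G$ is $\delta$-hyperbolic for some $\delta \le i + \left\lceil \frac{i+1}{2}\right\rceil \le \frac{3}{2}(i+1)$.
   Context: All graphs are finite, undirected, unweighted, simple and connected; $d(u,v)$ is the shortest-path distance, and the interval is $I(u,v)=\{w : d(u,v)=d(u,w)+d(w,v)\}$. A graph is $\alpha_i$-metric if for all vertices $u,v,w,x$ such that $v\in I(u,w)$, $w \in I(v,x)$ and $v,w$ are adjacent, one has $d(u,x)\ge d(u,v)+d(v,x)-i$. A graph is $\delta$-hyperbolic ($\delta$ a nonnegative half-integer) if for all vertices $u,v,w,x$ with $d(u,v)+d(w,x)\le d(u,w)+d(v,x)\le d(u,x)+d(v,w)$ one has $d(u,x)+d(v,w)-d(u,w)-d(v,x)\le 2\delta$. *)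

theory Defs
  imports "Graph_Theory.Digraph_Component" "Graph_Theory.Shortest_Path"
begin

(* A finite simple undirected graph is a G with graph G (a symmetric, loop-free digraph without
   parallel arcs); an undirected edge is a pair of opposite arcs, and u, v are adjacent iff
   u \<rightarrow>\<^bsub>G\<^esub> v. *)

(* Meaningful only when v is reachable from u; otherwise the LEAST is unspecified. *)
definition gdist :: "('a, 'b) pre_digraph \<Rightarrow> 'a \<Rightarrow> 'a \<Rightarrow> nat" where
  "gdist G u v = (LEAST n. \<exists>p. pre_digraph.apath G u p v \<and> length p = n)"

definition geodesic_interval :: "('a, 'b) pre_digraph \<Rightarrow> 'a \<Rightarrow> 'a \<Rightarrow> 'a set" where
  "geodesic_interval G u v = {w \<in> verts G. gdist G u v = gdist G u w + gdist G w v}"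

definition alpha_metric :: "nat \<Rightarrow> ('a, 'b) pre_digraph \<Rightarrow> bool" where
  "alpha_metric i G \<longleftrightarrow>
     (\<forall>u\<in>verts G. \<forall>v\<in>verts G. \<forall>w\<in>verts G. \<forall>x\<in>verts G.
        v \<in> geodesic_interval G u w \<and> w \<in> geodesic_interval G v x \<and> v \<rightarrow>\<^bsub>G\<^esub> w \<longrightarrow>
        int (gdist G u x) \<ge> int (gdist G u v) + int (gdist G v x) - int i)"

(* 2 * \<delta> \<in> \<int> together with \<delta> \<ge> 0 says that \<delta> ranges over 0, 1/2, 1, 3/2, ... *)
definition hyperbolic :: "real \<Rightarrow> ('a, 'b) pre_digraph \<Rightarrow> bool" where
  "hyperbolic \<delta> G \<longleftrightarrow>
     \<delta> \<ge> 0 \<and> 2 * \<delta> \<in> \<int> \<and>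
     (\<forall>u\<in>verts G. \<forall>v\<in>verts G. \<forall>w\<in>verts G. \<forall>x\<in>verts G.
        gdist G u v + gdist G w x \<le> gdist G u w + gdist G v x \<and>
        gdist G u w + gdist G v x \<le> gdist G u x + gdist G v w \<longrightarrow>
        real (gdist G u x) + real (gdist G v w) - real (gdist G u w) - real (gdist G v x)
          \<le> 2 * \<delta>)"

lemma (in wf_digraph) awalk_cost_unit: "awalk_cost (\<lambda>_. 1) p = real (length p)"
  by (induction p) auto

(* gdist agrees with the weighted distance of the library for unit arc weights. *)
lemma (in fin_digraph) gdist_eq_mu:
  assumes "u \<rightarrow>\<^sup>* v"
  shows "ereal (real (gdist G u v)) = \<mu> (\<lambda>_. 1) u v"
proof -
  have "\<exists>n p. apath u p v \<and> length p = n"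
    using assms by (auto simp: reachable_apath)
  then have "\<exists>p. apath u p v \<and> length p = gdist G u v"
    unfolding gdist_def by (rule LeastI_ex)
  then obtain p where p: "apath u p v" "length p = gdist G u v" by blast
  obtain q where q: "apath u q v" "\<mu> (\<lambda>_. 1) u v = awalk_cost (\<lambda>_. 1) q"
    using min_cost_awalk[OF assms, of "\<lambda>_. 1"] by auto
  have "gdist G u v \<le> length q"
    unfolding gdist_def using q(1) by (auto intro: Least_le)
  then have "ereal (real (gdist G u v)) \<le> \<mu> (\<lambda>_. 1) u v"
    using q(2) by (simp add: awalk_cost_unit)
  moreover have "\<mu> (\<lambda>_. 1) u v \<le> ereal (real (gdist G u v))"
    using min_cost_le_walk_cost[OF awalkI_apath[OF p(1)], of "\<lambda>_. 1"] p(2)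
    by (simp add: awalk_cost_unit)
  ultimately show ?thesis by (rule antisym)
qed

end

theory Submission
  imports Defs
begin

text \<open>
  Two equidistant points of an interval are at distance at most \<open>i + 1\<close>: a pair at a larger
  distance \<open>k\<close> can be pushed one step towards an end of the interval, the distance staying \<open>k\<close>.
  Moreover every interval \<open>I(x, y)\<close> contains a point, or an edge \<open>pq\<close> of an \<open>x\<close>--\<open>y\<close> geodesic,
  that lies up to an excess \<open>i\<close> on geodesics from \<open>z\<close> to \<open>x\<close> (for \<open>p\<close>) and from \<open>z\<close> to \<open>y\<close>
  (for \<open>q\<close>): walk through the points of the interval closest to \<open>z\<close>. Comparing such centres for
  \<open>z\<close> and \<open>w\<close> on a common level of \<open>I(x, y)\<close> bounds the difference of the two largest distance
  sums by \<open>3 i + 2\<close>. Equality forces an odd perimeter of the triangles \<open>xyz\<close> and, exchanging the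
  two diagonals, \<open>xzw\<close>; for odd \<open>i\<close> this contradicts parity, so the bound improves to \<open>3 i + 1\<close>.
\<close>

section \<open>The \<open>\<alpha>\<^sub>i\<close> property in integer-valued geodesic metrics\<close>

text \<open>Adjacency becomes distance 1, and \<open>geodesic_step\<close> replaces shortest paths,
  so the argument below is pure arithmetic of distances.\<close>

locale alpha_geodesic_metric =
  fixes V :: "'a set" and d :: "'a \<Rightarrow> 'a \<Rightarrow> nat" and i :: nat
  assumes dist_self: "u \<in> V \<Longrightarrow> d u u = 0"
    and dist_eq_0: "u \<in> V \<Longrightarrow> v \<in> V \<Longrightarrow> d u v = 0 \<Longrightarrow> u = v"
    and dist_sym: "u \<in> V \<Longrightarrow> v \<in> V \<Longrightarrow> d u v = d v u"
    and dist_triangle: "u \<in> V \<Longrightarrow> v \<in> V \<Longrightarrow> w \<in> V \<Longrightarrow> d u w \<le> d u v + d v w"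
    and geodesic_step: "u \<in> V \<Longrightarrow> v \<in> V \<Longrightarrow> u \<noteq> v \<Longrightarrow> \<exists>w\<in>V. d u w = 1 \<and> d u v = Suc (d w v)"
    and alpha: "u \<in> V \<Longrightarrow> v \<in> V \<Longrightarrow> w \<in> V \<Longrightarrow> x \<in> V \<Longrightarrow> d v w = 1 \<Longrightarrow>
      d u w = d u v + 1 \<Longrightarrow> d v x = 1 + d w x \<Longrightarrow> d u v + d v x \<le> d u x + i"
begin

definition between :: "'a \<Rightarrow> 'a \<Rightarrow> 'a \<Rightarrow> bool" where
  "between x p y \<longleftrightarrow> p \<in> V \<and> d x p + d p y = d x y"

lemma between_sym: "x \<in> V \<Longrightarrow> y \<in> V \<Longrightarrow> between x p y \<Longrightarrow> between y p x"
  unfolding between_def using dist_sym by (metis add.commute)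

lemma geodesic_point:
  assumes "x \<in> V" "q \<in> V" "n \<le> d x q"
  shows "\<exists>r. between x r q \<and> d x r = n"
  using assms(3)
proof (induction n)
  case 0
  show ?case
    using assms dist_self by (intro exI[of _ x]) (auto simp: between_def)
next
  case (Suc n)
  then obtain r where r: "r \<in> V" "d x r + d r q = d x q" "d x r = n"
    by (auto simp: between_def)
  with Suc.prems have "r \<noteq> q"
    using dist_self[OF assms(2)] by auto
  then obtain s where s: "s \<in> V" "d r s = 1" "d r q = Suc (d s q)"
    using geodesic_step r(1) assms(2) by blast
  have "d x s \<le> d x r + d r s" "d x q \<le> d x s + d s q"
    using dist_triangle assms(1,2) r(1) s(1) by auto
  with r s show ?case
    by (intro exI[of _ s]) (auto simp: between_def)
qed

lemma between_trans:
  assumes "x \<in> V" "y \<in> V" "between x q y" "between x r q"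
  shows "between x r y"
proof -
  have V: "q \<in> V" "r \<in> V"
    using assms by (auto simp: between_def)
  have "d r y \<le> d r q + d q y" "d x y \<le> d x r + d r y"
    using dist_triangle assms(1,2) V by auto
  with assms(3,4) show ?thesis
    by (auto simp: between_def)
qed

lemma between_step:
  assumes "x \<in> V" "y \<in> V" "between x p y" "p \<noteq> y"
  obtains q where "between x q y" "d p q = 1" "d x q = Suc (d x p)" "d p y = Suc (d q y)"
proof -
  obtain q where q: "q \<in> V" "d p q = 1" "d p y = Suc (d q y)"
    using geodesic_step assms by (metis between_def)
  have "d x q \<le> d x p + d p q" "d x y \<le> d x q + d q y"
    using dist_triangle assms q(1) by (auto simp: between_def)
  with q assms(3) show thesis
    by (intro that[of q]) (auto simp: between_def)
qed

section \<open>Thinness of intervals\<close>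

text \<open>The distance to \<open>w\<close> changes by at most 1 along the edge from
  \<open>v\<close> to \<open>v'\<close>. An increase lets \<open>alpha\<close> act on this edge
  towards \<open>y\<close>, a decrease on the reversed edge towards \<open>x\<close>; since
  \<open>v\<close> and \<open>w\<close> are on one level, either case forces
  \<open>d v w \<le> i\<close>.\<close>

lemma far_pair_step:
  assumes "x \<in> V" "y \<in> V" "between x v y" "between x w y" "d x v = d x w"
    and "d v w > i" "between x v' y" "d v v' = 1" "d v y = Suc (d v' y)"
  shows "d v' w = d v w"
proof -
  have V: "v \<in> V" "w \<in> V" "v' \<in> V"
    using assms by (auto simp: between_def)
  have "d w v' \<le> d w v + d v v'" "d w v \<le> d w v' + d v' v"
    using dist_triangle V by auto
  then consider "d w v' = d w v" | "d w v' = d w v + 1" | "d w v = d w v' + 1"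
    using assms(8) dist_sym V by fastforce
  then show ?thesis
  proof cases
    case 1
    then show ?thesis using dist_sym V by auto
  next
    case 2
    then have "d w v + d v y \<le> d w y + i"
      using alpha[of w v v' y] assms V by auto
    then show ?thesis
      using assms dist_sym V by (auto simp: between_def)
  next
    case 3
    moreover have "d v' x = 1 + d v x"
      using assms dist_sym V by (auto simp: between_def)
    ultimately have "d w v' + d v' x \<le> d w x + i"
      using alpha[of w v' v x] assms V dist_sym by auto
    moreover have "d w x = d v x" "d w v = d v w"
      using assms(1,5) dist_sym V by auto
    ultimately show ?thesis
      using 3 \<open>d v' x = 1 + d v x\<close> assms(6) by linarith
  qed
qed

lemma interval_thin:
  assumes "x \<in> V" "y \<in> V" "between x v y" "between x w y" "d x v = d x w"
  shows "d v w \<le> i + 1"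
  using assms(3-5)
proof (induction "d v y" arbitrary: v w)
  case 0
  then have "d w y = 0" "v \<in> V" "w \<in> V"
    by (auto simp: between_def)
  with 0 have "v = y" "w = y"
    using dist_eq_0 assms(2) by auto
  then show ?case
    using dist_self assms(2) by simp
next
  case (Suc n)
  show ?case
  proof (rule ccontr)
    assume far: "\<not> ?thesis"
    have ne: "v \<noteq> y" "w \<noteq> y"
      using Suc.hyps(2) Suc.prems dist_self[OF assms(2)] by (auto simp: between_def)
    obtain v' where v': "between x v' y" "d v v' = 1" "d x v' = Suc (d x v)" "d v y = Suc (d v' y)"
      using between_step[OF assms(1,2) Suc.prems(1) ne(1)] by blast
    obtain w' where w': "between x w' y" "d w w' = 1" "d x w' = Suc (d x w)" "d w y = Suc (d w' y)"
      using between_step[OF assms(1,2) Suc.prems(2) ne(2)] by blast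
    have V: "v \<in> V" "w \<in> V" "v' \<in> V" "w' \<in> V"
      using Suc.prems v' w' by (auto simp: between_def)
    have eq: "d v' w = d v w"
      using far_pair_step[OF assms(1,2) Suc.prems(1-3)] far v' by auto
    have "d v' w \<le> d v' w' + d w' w"
      using dist_triangle V by auto
    \<comment> \<open>Starting from at least \<open>i + 2\<close>, the pair can lose one unit here
      and still exceed \<open>i\<close>, so the second push is allowed.\<close>
    then have far': "d v' w' > i"
      using eq far w'(2) dist_sym[of w w'] V by linarith
    \<comment> \<open>The second push is read backwards: from \<open>w'\<close> to \<open>w\<close>,
      with the ends of the interval exchanged, as \<open>v'\<close> and \<open>w'\<close> share a
      level.\<close>
    have "d w v' = d w' v'"
    proof (rule far_pair_step[OF assms(2,1)])
      show "between y w' x" "between y v' x" "between y w x"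
        using v'(1) w'(1) Suc.prems(2) assms by (auto intro: between_sym)
      show "d y w' = d y v'" "d w' x = Suc (d w x)"
        using v' w' Suc.prems assms(1,2) V dist_sym[of y] dist_sym[of _ x]
        by (auto simp: between_def)
      show "i < d w' v'" "d w' w = 1"
        using far' w'(2) dist_sym V by auto
    qed
    then have "d v' w' = d v w"
      using eq dist_sym V by auto
    moreover have "d v' w' \<le> i + 1"
      using Suc.hyps v' w' Suc.prems by auto
    ultimately show False
      using far by simp
  qed
qed

section \<open>Centres of triangles\<close>

text \<open>A neighbour \<open>q\<close> of \<open>p\<close> towards \<open>z\<close> is closer to
  \<open>z\<close>, hence outside the interval, hence farther than \<open>p\<close> from
  \<open>x\<close> or from \<open>y\<close>. Then \<open>alpha\<close> applies to the edge from
  \<open>q\<close> to \<open>p\<close>, and the unit lost towards \<open>z\<close> is regained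
  towards that end.\<close>

lemma nearest_point_alternative:
  assumes V: "x \<in> V" "y \<in> V" "z \<in> V" and p: "between x p y"
    and min: "\<And>r. between x r y \<Longrightarrow> d z p \<le> d z r"
  shows "d z p + d x p \<le> d z x + i \<or> d z p + d p y \<le> d z y + i"
proof (cases "p = z")
  case True
  then show ?thesis
    using dist_self dist_sym V by auto
next
  case False
  have pV: "p \<in> V"
    using p by (simp add: between_def)
  obtain q where q: "q \<in> V" "d p q = 1" "d p z = Suc (d q z)"
    using geodesic_step[OF pV V(3) False] by blast
  have sym: "d q p = 1" "d z p = d z q + 1" "d p x = d x p" "d q x = d x q"
    using q pV V dist_sym by auto
  have "\<not> between x q y"
    using min[of q] sym(2) by auto
  moreover have "d x y \<le> d x q + d q y" "d x q \<le> d x p + d p q" "d q y \<le> d q p + d p y"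
    using dist_triangle pV q(1) V by auto
  ultimately have "d q x = 1 + d p x \<or> d q y = 1 + d p y"
    using sym q p by (auto simp: between_def)
  then show ?thesis
  proof
    assume "d q x = 1 + d p x"
    then have "d z q + d q x \<le> d z x + i"
      using alpha[of z q p x] sym q pV V by auto
    with sym \<open>d q x = 1 + d p x\<close> show ?thesis by linarith
  next
    assume "d q y = 1 + d p y"
    then have "d z q + d q y \<le> d z y + i"
      using alpha[of z q p y] sym q pV V by auto
    with sym \<open>d q y = 1 + d p y\<close> show ?thesis by linarith
  qed
qed

text \<open>An approximate median of \<open>x\<close>, \<open>y\<close>, \<open>z\<close> with
  excess \<open>i\<close>, possibly split over two consecutive levels.\<close>

definition center :: "'a \<Rightarrow> 'a \<Rightarrow> 'a \<Rightarrow> 'a \<Rightarrow> 'a \<Rightarrow> bool" where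
  "center x y z p q \<longleftrightarrow> between x p y \<and> between x q y \<and>
     d z p + d x p \<le> d z x + i \<and> d z q + d q y \<le> d z y + i \<and>
     (p = q \<or> d x q = d x p + 1 \<and> d z p = d z q)"

lemma center_sym:
  assumes V: "x \<in> V" "y \<in> V" and c: "center y x z p q"
  shows "center x y z q p"
proof -
  have b: "between y p x" "between y q x"
    using c by (auto simp: center_def)
  then have "d x p = d p x" "d x q = d q x" "d p y = d y p" "d q y = d y q"
    using dist_sym V by (auto simp: between_def)
  moreover have "between x p y" "between x q y"
    using b between_sym[OF V(2,1)] by auto
  moreover have "d y x = d x y"
    using dist_sym V by auto
  ultimately show ?thesis
    using c unfolding center_def between_def by auto
qed

text \<open>Walk from \<open>p\<close> towards \<open>y\<close> along points nearest to
  \<open>z\<close> until the inequality for \<open>y\<close> holds, which happens at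
  \<open>y\<close> at the latest.\<close>

lemma center_walk:
  assumes V: "x \<in> V" "y \<in> V" "z \<in> V" and p: "between x p y"
    and min: "\<And>r. between x r y \<Longrightarrow> d z p \<le> d z r"
    and "d z p + d x p \<le> d z x + i"
  shows "\<exists>p q. center x y z p q"
  using p min assms(6)
proof (induction "d p y" arbitrary: p rule: less_induct)
  case less
  note p = less.prems(1) and min = less.prems(2)
  show ?case
  proof (cases "d z p + d p y \<le> d z y + i")
    case True
    then have "center x y z p p"
      using less.prems by (auto simp: center_def)
    then show ?thesis by blast
  next
    case False
    then have "p \<noteq> y"
      using dist_self V by auto
    then obtain q where q: "between x q y" "d p q = 1" "d x q = Suc (d x p)" "d p y = Suc (d q y)"
      using between_step[OF V(1,2) p] by blast
    have pqV: "p \<in> V" "q \<in> V"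
      using p q by (auto simp: between_def)
    \<comment> \<open>Otherwise \<open>alpha\<close> on the edge from \<open>p\<close> to
      \<open>q\<close> would give the inequality for \<open>y\<close> at \<open>p\<close>.\<close>
    have "d z q \<noteq> d z p + 1"
      using alpha[of z p q y] False q pqV V by auto
    moreover have "d z q \<le> d z p + d p q"
      using dist_triangle pqV V by auto
    ultimately have eq: "d z p = d z q"
      using min[OF q(1)] q(2) by auto
    then have min': "d z q \<le> d z r" if "between x r y" for r
      using min that by simp
    consider "d z q + d x q \<le> d z x + i" | "d z q + d q y \<le> d z y + i"
      using nearest_point_alternative[OF V q(1) min'] by blast
    then show ?thesis
    proof cases
      case 1
      then show ?thesis
        using less.hyps[OF _ q(1) min'] q(4) by auto
    next
      case 2
      then have "center x y z p q"
        using less.prems(3) p q eq by (auto simp: center_def)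
      then show ?thesis by blast
    qed
  qed
qed

lemma center_exists:
  assumes V: "x \<in> V" "y \<in> V" "z \<in> V"
  obtains p q where "center x y z p q"
proof -
  have "between x x y"
    using V dist_self by (simp add: between_def)
  then obtain p where p: "between x p y" and min: "\<And>r. between x r y \<Longrightarrow> d z p \<le> d z r"
    using ex_has_least_nat[of "\<lambda>p. between x p y" x "d z"] by auto
  consider "d z p + d x p \<le> d z x + i" | "d z p + d p y \<le> d z y + i"
    using nearest_point_alternative[OF V p min] by blast
  then have "\<exists>p q. center x y z p q"
  proof cases
    case 1
    then show ?thesis using center_walk[OF V p min] by blast
  next
    case 2
    have "d z p \<le> d z r" if "between y r x" for r
      using min between_sym[OF V(2,1) that] .
    moreover have "d p y = d y p"
      using p V dist_sym by (auto simp: between_def)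
    ultimately have "\<exists>p q. center y x z p q"
      using center_walk[OF V(2,1,3) between_sym[OF V(1,2) p]] 2 by auto
    then show ?thesis using center_sym[OF V(1,2)] by blast
  qed
  then show thesis using that by blast
qed

section \<open>The four-point inequality\<close>

text \<open>Route \<open>z\<close> to \<open>w\<close> through \<open>p\<close>, \<open>r\<close>,
  \<open>q\<close>, where \<open>r\<close> is on the level of \<open>p\<close> and on a geodesic
  from \<open>x\<close> to \<open>q\<close>. Each centre costs \<open>i\<close>, and crossing the
  level costs \<open>i + 1\<close>.\<close>

lemma four_point_levels:
  assumes V: "x \<in> V" "y \<in> V" "z \<in> V" "w \<in> V"
    and "between x p y" "between x q y" "d x p \<le> d x q"
    and "d z p + d p y \<le> d z y + i" "d w q + d x q \<le> d w x + i"
  shows "d x y + d z w \<le> d z y + d x w + 3 * i + 1"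
proof -
  have pqV: "p \<in> V" "q \<in> V"
    using assms by (auto simp: between_def)
  obtain r where r: "between x r q" "d x r = d x p"
    using geodesic_point[of x q "d x p"] assms pqV by auto
  have rV: "r \<in> V"
    using r by (simp add: between_def)
  have "between x r y"
    using between_trans[OF V(1,2) assms(6) r(1)] by blast
  then have "d p r \<le> i + 1"
    using interval_thin[OF V(1,2) assms(5)] r(2) by auto
  moreover have "d z w \<le> d z p + d p w" "d p w \<le> d p r + d r w" "d r w \<le> d r q + d q w"
    using dist_triangle V pqV rV by auto
  moreover have "d q w = d w q" "d x w = d w x"
    using dist_sym pqV V by auto
  ultimately show ?thesis
    using assms(5,8,9) r unfolding between_def by linarith
qed

lemma four_point:
  assumes V: "x \<in> V" "y \<in> V" "z \<in> V" "w \<in> V"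
    and "d z y + d x w + 3 * i + 1 < d x y + d z w" "d z x + d y w + 3 * i + 1 < d x y + d z w"
  shows "d x y + d z w = d z y + d x w + 3 * i + 2" "odd (d x y + d z x + d z y)"
proof -
  obtain p p' where P: "center x y z p p'"
    using center_exists V by blast
  obtain q q' where Q: "center x y w q q'"
    using center_exists V by blast
  have b: "between x p y" "between x p' y" "between x q y" "between x q' y"
    using P Q by (auto simp: center_def)
  then have bV: "p \<in> V" "p' \<in> V" "q \<in> V" "q' \<in> V"
    by (auto simp: between_def)
  have sym: "d x w = d w x" "d y w = d w y" "d q w = d w q"
    using dist_sym V bV by auto
  have "d x q < d x p'"
  proof (rule ccontr)
    assume "\<not> ?thesis"
    then show False
      using four_point_levels[OF V b(2,3)] P Q assms(5) by (auto simp: center_def)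
  qed
  moreover have "d x p < d x q'"
  proof -
    have "d x y + d w z \<le> d w y + d x z + 3 * i + 1" if "d x q' \<le> d x p"
      using four_point_levels[OF V(1,2,4,3) b(4,1) that] P Q by (auto simp: center_def)
    moreover have "d w z = d z w" "d x z = d z x"
      using dist_sym V by auto
    ultimately show ?thesis using assms(6) sym by linarith
  qed
  \<comment> \<open>Each centre spans at most two consecutive levels, so the two strict inequalities
    make both centres split and start on the same level.\<close>
  ultimately have level: "d x p = d x q" "d x p' = d x p + 1" "d x q' = d x p + 1"
      "d z p = d z p'" "d w q = d w q'"
    using P Q by (auto simp: center_def)
  have thin: "d p q \<le> i + 1"
    using interval_thin[OF V(1,2)] b level by auto
  have "d z w \<le> d z p + d p w" "d p w \<le> d p q + d q w"
    using dist_triangle V bV by auto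
  then have zw: "d z w \<le> d z p + (i + 1) + d w q"
    using thin sym by linarith
  have P': "d z p + d x p \<le> d z x + i" "d z p' + d p' y \<le> d z y + i"
    and Q': "d w q + d x q \<le> d w x + i" "d w q' + d q' y \<le> d w y + i"
    using P Q by (auto simp: center_def)
  have B: "d x p + d p y = d x y" "d x p' + d p' y = d x y"
    "d x q + d q y = d x y" "d x q' + d q' y = d x y"
    using b by (auto simp: between_def)
  show "d x y + d z w = d z y + d x w + 3 * i + 2"
    using zw P' Q' B level sym assms(5,6) by linarith
  \<comment> \<open>The upper bound meets the assumed lower bound, so every estimate used is
    tight.\<close>
  have "d z p' + d p' y = d z y + i" "d z p + d x p = d z x + i"
    using zw P' Q' B level sym assms(5,6) by linarith+
  \<comment> \<open>The \<open>- 1\<close> is the level gap between \<open>p\<close> and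
    \<open>p'\<close>; positivity of \<open>d x y\<close> keeps the natural subtraction
    exact.\<close>
  then have "d x y + d z x + d z y + 2 * i = 2 * d z p + 2 * d x y - 1" "d x y > 0"
    using B level by linarith+
  then show "odd (d x y + d z x + d z y)" by presburger
qed

theorem four_point_bound:
  assumes V: "x \<in> V" "y \<in> V" "z \<in> V" "w \<in> V"
  shows "d x y + d z w \<le>
    max (d z y + d x w) (d z x + d y w) + 3 * i + (if odd i then 1 else 2)"
proof (rule ccontr)
  assume *: "\<not> ?thesis"
  then have big: "d z y + d x w + 3 * i + 1 < d x y + d z w" "d z x + d y w + 3 * i + 1 < d x y + d z w"
    by (auto split: if_splits)
  note xy = four_point[OF V big]
  then have "odd i"
    using * by (auto split: if_splits)
  have sym: "d x z = d z x" "d w z = d z w" "d y w = d w y" "d w x = d x w" "d y z = d z y"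
    using dist_sym V by auto
  \<comment> \<open>Adding the two odd perimeters makes \<open>d x y + d z w + d z y + d x w\<close>
    even, but the equality case gives it the parity of \<open>3 * i + 2\<close>.\<close>
  have "odd (d z w + d x z + d x w)"
  proof (rule four_point(2)[OF V(3,4,1,2)])
    show "d x w + d z y + 3 * i + 1 < d z w + d x y" "d x z + d w y + 3 * i + 1 < d z w + d x y"
      using big sym by linarith+
  qed
  with xy \<open>odd i\<close> sym show False by presburger
qed

end

section \<open>Distances in connected graphs\<close>

text \<open>\<open>gdist\<close> minimises over paths; going through \<open>\<mu>\<close> admits
  arbitrary walks, so concatenations need no loop removal.\<close>

lemma (in fin_digraph) gdist_le_length:
  assumes "awalk u p v"
  shows "gdist G u v \<le> length p"
proof -
  have "u \<rightarrow>\<^sup>* v"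
    using assms reachable_awalk by blast
  then have "ereal (real (gdist G u v)) \<le> ereal (real (length p))"
    using min_cost_le_walk_cost[OF assms, of "\<lambda>_. 1"]
    by (simp add: gdist_eq_mu awalk_cost_unit)
  then show ?thesis by simp
qed

lemma (in fin_digraph) gdist_awalk:
  assumes "u \<rightarrow>\<^sup>* v"
  obtains p where "awalk u p v" "length p = gdist G u v"
proof -
  obtain p where "awalk u p v" "\<mu> (\<lambda>_. 1) u v = awalk_cost (\<lambda>_. 1) p"
    using min_cost_awalk[OF assms, of "\<lambda>_. 1"] by (auto intro: awalkI_apath)
  with that show thesis
    using gdist_eq_mu[OF assms] by (simp add: awalk_cost_unit)
qed

lemma (in sym_digraph) awalk_reverse:
  assumes "awalk u p v"
  shows "\<exists>q. awalk v q u \<and> length q = length p"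
  using assms
proof (induction p arbitrary: u)
  case Nil
  then show ?case by (auto simp: awalk_Nil_iff)
next
  case (Cons e p)
  then have e: "e \<in> arcs G" "u = tail G e" and "awalk (head G e) p v"
    by (auto simp: awalk_Cons_iff)
  then obtain q where q: "awalk v q (head G e)" "length q = length p"
    using Cons.IH by blast
  obtain e' where e': "e' \<in> arcs G" "tail G e' = head G e" "head G e' = tail G e"
    using sym_arcs e(1) unfolding symmetric_conv by metis
  then have "awalk (head G e) [e'] u"
    using e by (auto simp: awalk_Cons_iff awalk_Nil_iff)
  with q show ?case
    by (intro exI[of _ "q @ [e']"]) (auto simp del: awalk_append_iff intro: awalk_appendI)
qed

lemma alpha_geodesic_metric_gdist:
  assumes "graph G" and conn: "Digraph_Component.connected G" and alpha: "alpha_metric i G"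
  shows "alpha_geodesic_metric (verts G) (gdist G) i"
proof -
  interpret graph G by fact
  have reach: "u \<rightarrow>\<^sup>*\<^bsub>G\<^esub> v" if "u \<in> verts G" "v \<in> verts G" for u v
    using conn that reachable_mk_symmetric_eq[OF sym_arcs]
    unfolding Digraph_Component.connected_def strongly_connected_def by auto
  have sym_le: "gdist G v u \<le> gdist G u v" if uv: "u \<in> verts G" "v \<in> verts G" for u v
  proof -
    obtain p where p: "awalk u p v" "length p = gdist G u v"
      using gdist_awalk reach uv by blast
    then obtain q where "awalk v q u" "length q = length p"
      using awalk_reverse by blast
    then show ?thesis
      using gdist_le_length p(2) by metis
  qed
  have triangle: "gdist G u w \<le> gdist G u v + gdist G v w"
    if uvw: "u \<in> verts G" "v \<in> verts G" "w \<in> verts G" for u v w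
  proof -
    obtain p where "awalk u p v" "length p = gdist G u v"
      using gdist_awalk reach uvw by blast
    moreover obtain q where "awalk v q w" "length q = gdist G v w"
      using gdist_awalk reach uvw by blast
    ultimately show ?thesis
      using gdist_le_length[OF awalk_appendI, of u p v q w] by simp
  qed
  have eq_0: "u = v" if uv: "u \<in> verts G" "v \<in> verts G" "gdist G u v = 0" for u v
    using gdist_awalk[OF reach[OF uv(1,2)]] uv(3) by (metis awalk_Nil_iff length_0_conv)
  have self: "gdist G u u = 0" if "u \<in> verts G" for u
    using gdist_le_length[of u "[]" u] that by (simp add: awalk_Nil_iff)
  have step: "\<exists>w\<in>verts G. gdist G u w = 1 \<and> gdist G u v = Suc (gdist G w v)"
    if uv: "u \<in> verts G" "v \<in> verts G" "u \<noteq> v" for u v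
  proof -
    obtain p where p: "awalk u p v" "length p = gdist G u v"
      using gdist_awalk reach uv by blast
    with uv obtain e q where p_eq: "p = e # q"
      by (cases p) (auto simp: awalk_Nil_iff)
    \<comment> \<open>The first vertex after \<open>u\<close> on a shortest walk: the upper bounds 1
      and \<open>length q\<close> are attained by the triangle inequality.\<close>
    let ?w = "head G e"
    have e: "e \<in> arcs G" "u = tail G e" and q: "awalk ?w q v"
      using p p_eq by (auto simp: awalk_Cons_iff)
    then have w: "?w \<in> verts G" by auto
    have "awalk u [e] ?w"
      using e w by (auto simp: awalk_Cons_iff awalk_Nil_iff)
    then have "gdist G u ?w \<le> 1"
      using gdist_le_length[of u "[e]" ?w] by simp
    moreover have "gdist G ?w v \<le> length q"
      using gdist_le_length q by blast
    ultimately show ?thesis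
      using triangle[OF uv(1) w uv(2)] p p_eq w by (intro bexI[of _ ?w]) auto
  qed
  have adj: "v \<rightarrow>\<^bsub>G\<^esub> w" if vw: "v \<in> verts G" "w \<in> verts G" "gdist G v w = 1" for v w
  proof -
    obtain p where p: "awalk v p w" "length p = 1"
      using gdist_awalk[OF reach[OF vw(1,2)]] vw(3) by metis
    then obtain e where "p = [e]"
      by (auto simp: length_Suc_conv)
    with p have "e \<in> arcs G" "tail G e = v" "head G e = w"
      by (auto simp: awalk_Cons_iff awalk_Nil_iff)
    then show ?thesis
      using in_arcs_imp_in_arcs_ends by blast
  qed
  show ?thesis
  proof
    fix u v w x
    assume *: "u \<in> verts G" "v \<in> verts G" "w \<in> verts G" "x \<in> verts G" "gdist G v w = 1"
      "gdist G u w = gdist G u v + 1" "gdist G v x = 1 + gdist G w x"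
    then have "v \<in> geodesic_interval G u w" "w \<in> geodesic_interval G v x"
      by (auto simp: geodesic_interval_def)
    then have "int (gdist G u x) \<ge> int (gdist G u v) + int (gdist G v x) - int i"
      using alpha * adj unfolding alpha_metric_def by blast
    then show "gdist G u v + gdist G v x \<le> gdist G u x + i"
      by linarith
  qed (simp_all add: self eq_0 sym_le triangle step[unfolded One_nat_def] antisym)
qed

theorem theorem2:
  fixes G :: "('a, 'b) pre_digraph" and i :: nat
  assumes "graph G"
    and "Digraph_Component.connected G"
    and "alpha_metric i G"
  shows "(\<exists>\<delta>::real. hyperbolic \<delta> G \<and> \<delta> \<le> real i + real_of_int \<lceil>(real i + 1) / 2\<rceil>) \<and>
         real i + real_of_int \<lceil>(real i + 1) / 2\<rceil> \<le> 3 / 2 * (real i + 1)"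
proof -
  interpret alpha_geodesic_metric "verts G" "gdist G" i
    by (rule alpha_geodesic_metric_gdist) fact+
  define \<delta> where "\<delta> = real i + real_of_int \<lceil>(real i + 1) / 2\<rceil>"
  \<comment> \<open>The ceiling is \<open>k + 1\<close> both for \<open>i = 2 * k\<close> and for
    \<open>i = 2 * k + 1\<close>, which yields exactly the constant of
    \<open>four_point_bound\<close>.\<close>
  have two_delta: "2 * \<delta> = real (3 * i + (if odd i then 1 else 2))"
  proof (cases "odd i")
    case True
    then obtain k where "i = 2 * k + 1" by (auto elim: oddE)
    moreover from this have "\<lceil>(real i + 1) / 2\<rceil> = int k + 1"
      by (intro ceiling_unique) auto
    ultimately show ?thesis by (simp add: \<delta>_def)
  next
    case False
    then obtain k where "i = 2 * k" by (auto elim: evenE)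
    moreover from this have "\<lceil>(real i + 1) / 2\<rceil> = int k + 1"
      by (intro ceiling_unique) auto
    ultimately show ?thesis by (simp add: \<delta>_def)
  qed
  have "hyperbolic \<delta> G"
    unfolding hyperbolic_def two_delta
  proof (intro conjI ballI impI)
    have "2 * \<delta> \<ge> 0"
      unfolding two_delta by simp
    then show "\<delta> \<ge> 0" by linarith
  next
    fix u v w x
    assume V: "u \<in> verts G" "v \<in> verts G" "w \<in> verts G" "x \<in> verts G"
      and sums: "gdist G u v + gdist G w x \<le> gdist G u w + gdist G v x \<and>
        gdist G u w + gdist G v x \<le> gdist G u x + gdist G v w"
    have "gdist G u x + gdist G v w \<le>
        gdist G u w + gdist G v x + 3 * i + (if odd i then 1 else 2)"
      \<comment> \<open>The pairs \<open>u\<close>, \<open>x\<close> and \<open>v\<close>,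
        \<open>w\<close> serve as diagonals; by \<open>sums\<close> the maximum is the middle
        sum.\<close>
      using four_point_bound[OF V(1,4,2,3)] sums dist_sym[OF V(1,2)] dist_sym[OF V(3,4)]
      by (auto simp: max_def split: if_splits)
    then show "real (gdist G u x) + real (gdist G v w) - real (gdist G u w) - real (gdist G v x)
        \<le> real (3 * i + (if odd i then 1 else 2))"
      by linarith
  qed simp
  moreover have "\<delta> \<le> 3 / 2 * (real i + 1)"
    using two_delta by (auto split: if_splits)
  ultimately show ?thesis
    unfolding \<delta>_def by blast
qed

end
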